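(* For every monoid $S$, the semigroups $T(S)$ and $A(S)$ are isomorphic. If $S\in\mathcal{IC}$ is not a monoid, then $T(S)$ is isomorphic to the subsemigroup $$A_1=\{(\overline{h}\,\overline{s})\rho,\ (\overline{h}\,\overline{s}\,\overline{h})\rho,\ (\overline{r}\,\overline{h}\,\overline{s})\rho,\ (\overline{r}\,\overline{h}\,\overline{s}\,\overline{h})\rho\ :\ r,s\in S\}$$ of $A(S)$.
   Context: For a semigroup $S$, $E(S)$ denotes its set of idempotents, and $S^1$ denotes $S$ itself if $S$ is a monoid, and otherwise $S$ with an identity $1$ adjoined. $S$ is idempotent covered ($S\in\mathcal{IC}$) if for every $s\in S$ there are $e,f\in E(S)$ with $se=s=fs$. Definition of $T(S)$: let $R_2=\{\sigma,\tau\}$ be the two-element right-zero semigroup, and let $T*R_2$ be the set $S\times S\times R_2$ with product $(t_1,s_1,\sigma)(t_2,s_2,\alpha_2)=(t_1s_2,\,s_1s_2,\,\alpha_2)$ and $(t_1,s_1,\tau)(t_2,s_2,\alpha_2)=(t_1t_2,\,s_1t_2,\,\alpha_2)$ (a semidirect product of $T=S\times S$ by $R_2$). Let $E=\{(s,t,\alpha)\in E(T*R_2):\ s\in S^1t\}$ and $T(S)=\langle E\rangle$, the subsemigroup generated by $E$; for $S\in\mathcal{IC}$ one has $T(S)=\{(s,t,\alpha)\in T*R_2: s\in S^1t\}$. Definition of $A(S)$: let $\overline{X}=\{\overline{h}\}\cup\{\overline{s}: s\in S^1\}$ be a set of distinct symbols, and let $F(S)$ be the semigroup given by the presentation with generators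 $\overline{X}$ and relations $\overline{x}^2=\overline{x}$, $\overline{h}\,\overline{1}=\overline{1}$, $\overline{1}\,\overline{h}=\overline{h}$, $\overline{s}\,\overline{t}=\overline{s}$, $\overline{h}\,\overline{s}\,\overline{h}\,\overline{t}=\overline{h}\,\overline{st}$ for all $\overline{x}\in\overline{X}$ and $s,t\in S^1$. It is known that $F(S)=\{\overline{s}\,\overline{h}\,\overline{t},\ \overline{s}\,\overline{h}\,\overline{t}\,\overline{h}: s,t\in S^1\}$, with all these elements pairwise distinct. Let $\rho=\{(\overline{s}\,\overline{h}\,\overline{t},\,\overline{r}\,\overline{h}\,\overline{t}),\ (\overline{s}\,\overline{h}\,\overline{t}\,\overline{h},\,\overline{r}\,\overline{h}\,\overline{t}\,\overline{h}):\ r,s,t\in S^1,\ st=rt\}$, which is a congruence on $F(S)$, and let $A(S)=F(S)/\rho$; $x\rho$ denotes the $\rho$-class of $x$. *)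

theory Defs
  imports "HOL-Algebra.Group"
begin

text \<open>Semigroups are monoid records of HOL-Algebra in which only the fields \<open>carrier\<close> and
  \<open>mult\<close> are used; the isomorphism relation \<open>\<cong>\<close> of HOL-Algebra likewise depends only on
  these two fields. The field \<open>one\<close> carries no information (it is \<open>undefined\<close> in records built
  by \<open>Sgp\<close>), so being a monoid means that some choice of \<open>one\<close> gives a monoid.\<close>

definition Sgp :: "'a set \<Rightarrow> ('a \<Rightarrow> 'a \<Rightarrow> 'a) \<Rightarrow> 'a monoid" where
  "Sgp C m = \<lparr>carrier = C, mult = m, one = undefined\<rparr>"

definition is_semigroup :: "('a, 'b) monoid_scheme \<Rightarrow> bool" where
  "is_semigroup S \<longleftrightarrow>
     (\<forall>x\<in>carrier S. \<forall>y\<in>carrier S. x \<otimes>\<^bsub>S\<^esub> y \<in> carrier S) \<and>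
     (\<forall>x\<in>carrier S. \<forall>y\<in>carrier S. \<forall>z\<in>carrier S.
        (x \<otimes>\<^bsub>S\<^esub> y) \<otimes>\<^bsub>S\<^esub> z = x \<otimes>\<^bsub>S\<^esub> (y \<otimes>\<^bsub>S\<^esub> z))"

definition is_monoid :: "('a, 'b) monoid_scheme \<Rightarrow> bool" where
  "is_monoid S \<longleftrightarrow> (\<exists>e. monoid (S\<lparr>one := e\<rparr>))"

definition subsemigroup :: "'a set \<Rightarrow> ('a, 'b) monoid_scheme \<Rightarrow> bool" where
  "subsemigroup H S \<longleftrightarrow> H \<subseteq> carrier S \<and> (\<forall>x\<in>H. \<forall>y\<in>H. x \<otimes>\<^bsub>S\<^esub> y \<in> H)"

inductive_set sgp_generate :: "('a, 'b) monoid_scheme \<Rightarrow> 'a set \<Rightarrow> 'a set"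
  for S and X where
  incl: "x \<in> X \<Longrightarrow> x \<in> sgp_generate S X"
| mult: "x \<in> sgp_generate S X \<Longrightarrow> y \<in> sgp_generate S X \<Longrightarrow> x \<otimes>\<^bsub>S\<^esub> y \<in> sgp_generate S X"

definition idempotents :: "('a, 'b) monoid_scheme \<Rightarrow> 'a set" where
  "idempotents S = {e \<in> carrier S. e \<otimes>\<^bsub>S\<^esub> e = e}"

definition idempotent_covered :: "('a, 'b) monoid_scheme \<Rightarrow> bool" where
  "idempotent_covered S \<longleftrightarrow>
     (\<forall>s\<in>carrier S. \<exists>e\<in>idempotents S. \<exists>f\<in>idempotents S. s \<otimes>\<^bsub>S\<^esub> e = s \<and> s = f \<otimes>\<^bsub>S\<^esub> s)"

text \<open>\<open>S\<^sup>1\<close>: an element \<open>s\<close> of \<open>S\<close> is represented by \<open>Some s\<close>, and \<open>None\<close> is the adjoined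
  identity, which lies in the carrier only if \<open>S\<close> is not a monoid.\<close>

definition S1 :: "('a, 'b) monoid_scheme \<Rightarrow> 'a option monoid" where
  "S1 S = \<lparr>carrier = (if is_monoid S then Some ` carrier S else insert None (Some ` carrier S)),
           mult = (\<lambda>x y. case x of None \<Rightarrow> y
                     | Some a \<Rightarrow> (case y of None \<Rightarrow> x | Some b \<Rightarrow> Some (a \<otimes>\<^bsub>S\<^esub> b))),
           one = (if is_monoid S then Some (THE e. monoid (S\<lparr>one := e\<rparr>)) else None)\<rparr>"


subsection \<open>The semigroup \<open>T(S)\<close>\<close>

datatype R2 = Sigma2 | Tau2

fun T_mult :: "('a, 'b) monoid_scheme \<Rightarrow> 'a \<times> 'a \<times> R2 \<Rightarrow> 'a \<times> 'a \<times> R2 \<Rightarrow> 'a \<times> 'a \<times> R2" where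
  "T_mult S (t1, s1, Sigma2) (t2, s2, a2) = (t1 \<otimes>\<^bsub>S\<^esub> s2, s1 \<otimes>\<^bsub>S\<^esub> s2, a2)"
| "T_mult S (t1, s1, Tau2) (t2, s2, a2) = (t1 \<otimes>\<^bsub>S\<^esub> t2, s1 \<otimes>\<^bsub>S\<^esub> t2, a2)"

definition T_star_R2 :: "('a, 'b) monoid_scheme \<Rightarrow> ('a \<times> 'a \<times> R2) monoid" where
  "T_star_R2 S = Sgp (carrier S \<times> carrier S \<times> UNIV) (T_mult S)"

definition T_gens :: "('a, 'b) monoid_scheme \<Rightarrow> ('a \<times> 'a \<times> R2) set" where
  "T_gens S = {(s, t, a). (s, t, a) \<in> idempotents (T_star_R2 S) \<and>
                 (\<exists>u\<in>carrier (S1 S). Some s = u \<otimes>\<^bsub>S1 S\<^esub> Some t)}"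

definition T_sgp :: "('a, 'b) monoid_scheme \<Rightarrow> ('a \<times> 'a \<times> R2) monoid" where
  "T_sgp S = (T_star_R2 S)\<lparr>carrier := sgp_generate (T_star_R2 S) (T_gens S)\<rparr>"


subsection \<open>Congruences, quotients and presentations\<close>

definition congruence :: "('a, 'b) monoid_scheme \<Rightarrow> ('a \<times> 'a) set \<Rightarrow> bool" where
  "congruence S c \<longleftrightarrow> equiv (carrier S) c \<and>
     (\<forall>(x, y)\<in>c. \<forall>z\<in>carrier S.
        (z \<otimes>\<^bsub>S\<^esub> x, z \<otimes>\<^bsub>S\<^esub> y) \<in> c \<and> (x \<otimes>\<^bsub>S\<^esub> z, y \<otimes>\<^bsub>S\<^esub> z) \<in> c)"

definition generated_congruence :: "('a, 'b) monoid_scheme \<Rightarrow> ('a \<times> 'a) set \<Rightarrow> ('a \<times> 'a) set" where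
  "generated_congruence S R = \<Inter> {c. congruence S c \<and> R \<subseteq> c}"

text \<open>For a congruence \<open>c\<close>, the product of two classes below is the class of the product of
  any representatives.\<close>

definition quotient_sgp :: "('a, 'b) monoid_scheme \<Rightarrow> ('a \<times> 'a) set \<Rightarrow> 'a set monoid" where
  "quotient_sgp S c = Sgp (carrier S // c) (\<lambda>P Q. \<Union>x\<in>P. \<Union>y\<in>Q. c `` {x \<otimes>\<^bsub>S\<^esub> y})"

definition free_sgp :: "'x set \<Rightarrow> 'x list monoid" where
  "free_sgp X = Sgp (lists X - {[]}) (@)"

definition presented_sgp :: "'x set \<Rightarrow> ('x list \<times> 'x list) set \<Rightarrow> 'x list set monoid" where
  "presented_sgp X R = quotient_sgp (free_sgp X) (generated_congruence (free_sgp X) R)"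


subsection \<open>The semigroup \<open>A(S)\<close>\<close>

datatype 's gen = Hbar | Bar 's

definition Xbar :: "('a, 'b) monoid_scheme \<Rightarrow> 'a option gen set" where
  "Xbar S = insert Hbar (Bar ` carrier (S1 S))"

definition F_rels :: "('a, 'b) monoid_scheme \<Rightarrow> ('a option gen list \<times> 'a option gen list) set" where
  "F_rels S =
     {([x, x], [x]) | x. x \<in> Xbar S} \<union>
     {([Hbar, Bar \<one>\<^bsub>S1 S\<^esub>], [Bar \<one>\<^bsub>S1 S\<^esub>]), ([Bar \<one>\<^bsub>S1 S\<^esub>, Hbar], [Hbar])} \<union>
     {([Bar s, Bar t], [Bar s]) | s t. s \<in> carrier (S1 S) \<and> t \<in> carrier (S1 S)} \<union>
     {([Hbar, Bar s, Hbar, Bar t], [Hbar, Bar (s \<otimes>\<^bsub>S1 S\<^esub> t)]) | s t.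
        s \<in> carrier (S1 S) \<and> t \<in> carrier (S1 S)}"

definition F_sgp :: "('a, 'b) monoid_scheme \<Rightarrow> 'a option gen list set monoid" where
  "F_sgp S = presented_sgp (Xbar S) (F_rels S)"

text \<open>The element of \<open>F(S)\<close> represented by a word over the generators.\<close>

definition F_word :: "('a, 'b) monoid_scheme \<Rightarrow> 'a option gen list \<Rightarrow> 'a option gen list set" where
  "F_word S w = generated_congruence (free_sgp (Xbar S)) (F_rels S) `` {w}"

definition rho :: "('a, 'b) monoid_scheme \<Rightarrow> ('a option gen list set \<times> 'a option gen list set) set" where
  "rho S =
     {(F_word S [Bar s, Hbar, Bar t], F_word S [Bar r, Hbar, Bar t]) | r s t.
        r \<in> carrier (S1 S) \<and> s \<in> carrier (S1 S) \<and> t \<in> carrier (S1 S) \<and>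
        s \<otimes>\<^bsub>S1 S\<^esub> t = r \<otimes>\<^bsub>S1 S\<^esub> t} \<union>
     {(F_word S [Bar s, Hbar, Bar t, Hbar], F_word S [Bar r, Hbar, Bar t, Hbar]) | r s t.
        r \<in> carrier (S1 S) \<and> s \<in> carrier (S1 S) \<and> t \<in> carrier (S1 S) \<and>
        s \<otimes>\<^bsub>S1 S\<^esub> t = r \<otimes>\<^bsub>S1 S\<^esub> t}"

definition A_sgp :: "('a, 'b) monoid_scheme \<Rightarrow> 'a option gen list set set monoid" where
  "A_sgp S = quotient_sgp (F_sgp S) (rho S)"

definition A_word :: "('a, 'b) monoid_scheme \<Rightarrow> 'a option gen list \<Rightarrow> 'a option gen list set set" where
  "A_word S w = rho S `` {F_word S w}"

definition A1 :: "('a, 'b) monoid_scheme \<Rightarrow> 'a option gen list set set set" where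
  "A1 S =
     {A_word S [Hbar, Bar (Some s)] | s. s \<in> carrier S} \<union>
     {A_word S [Hbar, Bar (Some s), Hbar] | s. s \<in> carrier S} \<union>
     {A_word S [Bar (Some r), Hbar, Bar (Some s)] | r s. r \<in> carrier S \<and> s \<in> carrier S} \<union>
     {A_word S [Bar (Some r), Hbar, Bar (Some s), Hbar] | r s. r \<in> carrier S \<and> s \<in> carrier S}"

end

theory Submission
  imports Defs
begin

text \<open>
  Write \<open>M\<close> for \<open>S\<^sup>1\<close>. Both semigroups are compared with the set of triples
  \<open>(p, q, \<alpha>)\<close> over \<open>M\<close> with \<open>p \<in> M q\<close>, multiplied as in \<open>M * R\<^sub>2\<close>.

  Sending \<open>\<^bold>s\<close> (the generator \<open>Bar s\<close>) to \<open>(s, 1, \<sigma>)\<close> and \<open>\<^bold>h\<close> (the generator \<open>Hbar\<close>) to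
  \<open>(1, 1, \<tau>)\<close> satisfies the defining relations of \<open>F(S)\<close>, so it gives every word over the
  generators a value that depends only on the element of \<open>F(S)\<close> it represents. The word
  \<open>\<^bold>s \<^bold>h \<^bold>t\<close> has value \<open>(st, t, \<sigma>)\<close>, and \<open>\<^bold>s \<^bold>h \<^bold>t \<^bold>h\<close> has value \<open>(st, t, \<tau>)\<close>. Hence the values
  are exactly the triples above (\<open>word_value_in\<close>, \<open>ex_word_value\<close>), and two words of this
  form have the same value if and only if their letters satisfy the condition that defines
  \<open>\<rho>\<close>. As every word can be rewritten to this form (\<open>word_cong_normal\<close>), \<open>\<rho>\<close> is
  precisely equality of values (\<open>rho_iff\<close>), and \<open>A(S)\<close> is isomorphic to the semigroup of triples.

  On the other side, if \<open>S\<close> is idempotent covered, then \<open>T(S)\<close> consists of all triples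
  over \<open>M\<close> of the above kind whose first two entries lie in \<open>S\<close> (\<open>carrier_T_sgp\<close>). So \<open>T(S)\<close>
  is isomorphic to the part of \<open>A(S)\<close> with values in \<open>S \<times> S \<times> R\<^sub>2\<close>
  (\<open>T_sgp_iso_Some_valued_A\<close>). This part is all of \<open>A(S)\<close> when \<open>S\<close> is a monoid, since then
  \<open>M = S\<close>. Otherwise, \<open>(st, t, \<alpha>)\<close> has its entries in \<open>S\<close> if and only if \<open>t \<in> S\<close>. The
  representatives with \<open>s \<in> S\<close> and those with \<open>s = 1\<close>, which shorten because
  \<open>\<^bold>1 \<^bold>h = \<^bold>h\<close>, are the four families of words that make up \<open>A\<^sub>1\<close>.
\<close>

section \<open>Congruences and quotients\<close>

lemma carrier_Sgp [simp]: "carrier (Sgp C m) = C"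
  and mult_Sgp [simp]: "mult (Sgp C m) = m"
  by (simp_all add: Sgp_def)

lemma congruence_equiv: "congruence S c \<Longrightarrow> equiv (carrier S) c"
  by (simp add: congruence_def)

lemma congruence_multL:
  "congruence S c \<Longrightarrow> (x, y) \<in> c \<Longrightarrow> z \<in> carrier S \<Longrightarrow> (z \<otimes>\<^bsub>S\<^esub> x, z \<otimes>\<^bsub>S\<^esub> y) \<in> c"
  by (auto simp: congruence_def)

lemma congruence_multR:
  "congruence S c \<Longrightarrow> (x, y) \<in> c \<Longrightarrow> z \<in> carrier S \<Longrightarrow> (x \<otimes>\<^bsub>S\<^esub> z, y \<otimes>\<^bsub>S\<^esub> z) \<in> c"
  by (auto simp: congruence_def)

lemma congruence_carrier: "congruence S c \<Longrightarrow> (x, y) \<in> c \<Longrightarrow> x \<in> carrier S \<and> y \<in> carrier S"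
  using congruence_equiv[of S c] unfolding equiv_def by blast

lemma congruence_refl: "congruence S c \<Longrightarrow> x \<in> carrier S \<Longrightarrow> (x, x) \<in> c"
  using congruence_equiv[of S c] refl_onD[of "carrier S" c x] unfolding equiv_def by blast

lemma congruence_sym: "congruence S c \<Longrightarrow> (x, y) \<in> c \<Longrightarrow> (y, x) \<in> c"
  using congruence_equiv[of S c] symD[of c x y] unfolding equiv_def by blast

lemma congruence_trans: "congruence S c \<Longrightarrow> (x, y) \<in> c \<Longrightarrow> (y, z) \<in> c \<Longrightarrow> (x, z) \<in> c"
  using congruence_equiv[of S c] transD[of c x y z] unfolding equiv_def by blast

lemma congruence_mult:
  assumes c: "congruence S c" and x: "(x, x') \<in> c" and y: "(y, y') \<in> c"
  shows "(x \<otimes>\<^bsub>S\<^esub> y, x' \<otimes>\<^bsub>S\<^esub> y') \<in> c"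
  using congruence_carrier[OF c x] congruence_carrier[OF c y]
  by (intro congruence_trans[OF c congruence_multR[OF c x] congruence_multL[OF c y]]) auto

lemma congruenceI:
  assumes "equiv (carrier S) c"
    and "\<And>x y z. (x, y) \<in> c \<Longrightarrow> z \<in> carrier S \<Longrightarrow> (z \<otimes>\<^bsub>S\<^esub> x, z \<otimes>\<^bsub>S\<^esub> y) \<in> c"
    and "\<And>x y z. (x, y) \<in> c \<Longrightarrow> z \<in> carrier S \<Longrightarrow> (x \<otimes>\<^bsub>S\<^esub> z, y \<otimes>\<^bsub>S\<^esub> z) \<in> c"
  shows "congruence S c"
  using assms unfolding congruence_def by blast

lemma quotient_mult_class:
  assumes c: "congruence S c" and x: "x \<in> carrier S" and y: "y \<in> carrier S"
  shows "c `` {x} \<otimes>\<^bsub>quotient_sgp S c\<^esub> c `` {y} = c `` {x \<otimes>\<^bsub>S\<^esub> y}"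
proof -
  have "c `` {x' \<otimes>\<^bsub>S\<^esub> y'} = c `` {x \<otimes>\<^bsub>S\<^esub> y}" if "x' \<in> c `` {x}" "y' \<in> c `` {y}" for x' y'
  proof -
    have "(x \<otimes>\<^bsub>S\<^esub> y, x' \<otimes>\<^bsub>S\<^esub> y') \<in> c"
      using that by (intro congruence_mult[OF c]) simp_all
    from equiv_class_eq[OF congruence_equiv[OF c] this] show ?thesis ..
  qed
  moreover have "x \<in> c `` {x}" "y \<in> c `` {y}"
    using congruence_refl[OF c] x y by auto
  ultimately have "(\<Union>x'\<in>c `` {x}. \<Union>y'\<in>c `` {y}. c `` {x' \<otimes>\<^bsub>S\<^esub> y'}) = c `` {x \<otimes>\<^bsub>S\<^esub> y}"
    by blast
  then show ?thesis
    by (simp add: quotient_sgp_def)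
qed

text \<open>Closure of the carrier makes the total relation one of the congruences that are
  intersected. It keeps the intersection inside the carrier, as an equivalence on the carrier
  must be; an empty family would give the universal relation of the type.\<close>

lemma congruence_generated:
  assumes closed: "\<And>x y. x \<in> carrier S \<Longrightarrow> y \<in> carrier S \<Longrightarrow> x \<otimes>\<^bsub>S\<^esub> y \<in> carrier S"
    and R: "R \<subseteq> carrier S \<times> carrier S"
  shows "congruence S (generated_congruence S R)"
proof (rule congruenceI)
  let ?G = "generated_congruence S R"
  have "congruence S (carrier S \<times> carrier S)"
    by (rule congruenceI) (auto simp: closed intro!: equivI refl_onI symI transI)
  then have sub: "?G \<subseteq> carrier S \<times> carrier S"
    using R unfolding generated_congruence_def by blast
  show "equiv (carrier S) ?G"
  proof (intro equivI refl_onI symI transI)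
    show "?G \<subseteq> carrier S \<times> carrier S" by (fact sub)
  next
    fix x assume "x \<in> carrier S"
    then show "(x, x) \<in> ?G"
      unfolding generated_congruence_def by (simp, meson congruence_refl)
  next
    fix x y assume "(x, y) \<in> ?G"
    then show "(y, x) \<in> ?G"
      unfolding generated_congruence_def by (simp, meson congruence_sym)
  next
    fix x y z assume "(x, y) \<in> ?G" "(y, z) \<in> ?G"
    then show "(x, z) \<in> ?G"
      unfolding generated_congruence_def by (simp, meson congruence_trans)
  qed
next
  fix x y z assume "(x, y) \<in> generated_congruence S R" "z \<in> carrier S"
  then have "(z \<otimes>\<^bsub>S\<^esub> x, z \<otimes>\<^bsub>S\<^esub> y) \<in> c \<and> (x \<otimes>\<^bsub>S\<^esub> z, y \<otimes>\<^bsub>S\<^esub> z) \<in> c"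
    if "congruence S c" "R \<subseteq> c" for c
    using that congruence_multL[of S c x y z] congruence_multR[of S c x y z]
    by (simp add: generated_congruence_def)
  then show "(z \<otimes>\<^bsub>S\<^esub> x, z \<otimes>\<^bsub>S\<^esub> y) \<in> generated_congruence S R"
    "(x \<otimes>\<^bsub>S\<^esub> z, y \<otimes>\<^bsub>S\<^esub> z) \<in> generated_congruence S R"
    by (simp_all add: generated_congruence_def)
qed

lemma generated_congruence_incl: "R \<subseteq> generated_congruence S R"
  by (auto simp: generated_congruence_def)

lemma generated_congruence_least:
  "congruence S c \<Longrightarrow> R \<subseteq> c \<Longrightarrow> generated_congruence S R \<subseteq> c"
  by (auto simp: generated_congruence_def)


section \<open>Adjoining an identity\<close>

lemma semigroup_closed:
  "is_semigroup S \<Longrightarrow> x \<in> carrier S \<Longrightarrow> y \<in> carrier S \<Longrightarrow> x \<otimes>\<^bsub>S\<^esub> y \<in> carrier S"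
  by (simp add: is_semigroup_def)

lemma semigroup_assoc:
  "is_semigroup S \<Longrightarrow> x \<in> carrier S \<Longrightarrow> y \<in> carrier S \<Longrightarrow> z \<in> carrier S \<Longrightarrow>
    x \<otimes>\<^bsub>S\<^esub> y \<otimes>\<^bsub>S\<^esub> z = x \<otimes>\<^bsub>S\<^esub> (y \<otimes>\<^bsub>S\<^esub> z)"
  by (simp add: is_semigroup_def)

lemma is_monoidE:
  assumes "is_monoid S"
  obtains e where "e \<in> carrier S" "\<And>x. x \<in> carrier S \<Longrightarrow> e \<otimes>\<^bsub>S\<^esub> x = x"
    "\<And>x. x \<in> carrier S \<Longrightarrow> x \<otimes>\<^bsub>S\<^esub> e = x" "\<one>\<^bsub>S1 S\<^esub> = Some e"
proof -
  obtain e where e: "monoid (S\<lparr>one := e\<rparr>)"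
    using assms by (auto simp: is_monoid_def)
  have "d = e" if "monoid (S\<lparr>one := d\<rparr>)" for d
    using monoid.one_closed[OF e] monoid.one_closed[OF that] monoid.r_one[OF e, of d]
      monoid.l_one[OF that, of e] by simp
  then have "(THE e. monoid (S\<lparr>one := e\<rparr>)) = e"
    using e by blast
  then show thesis
    using monoid.one_closed[OF e] monoid.l_one[OF e] monoid.r_one[OF e]
    by (intro that[of e]) (simp_all add: S1_def assms)
qed

lemma mult_S1 [simp]:
  "Some a \<otimes>\<^bsub>S1 S\<^esub> Some b = Some (a \<otimes>\<^bsub>S\<^esub> b)" "None \<otimes>\<^bsub>S1 S\<^esub> x = x" "x \<otimes>\<^bsub>S1 S\<^esub> None = x"
  by (auto simp: S1_def split: option.split)

lemma Some_in_S1 [simp]: "Some s \<in> carrier (S1 S) \<longleftrightarrow> s \<in> carrier S"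
  by (auto simp: S1_def)

lemma carrier_S1_monoid: "is_monoid S \<Longrightarrow> carrier (S1 S) = Some ` carrier S"
  by (simp add: S1_def)

lemma S1_adjoined:
  assumes "\<not> is_monoid S"
  shows "None \<in> carrier (S1 S)" "\<one>\<^bsub>S1 S\<^esub> = None"
  using assms by (simp_all add: S1_def)

lemma monoid_S1:
  assumes S: "is_semigroup S"
  shows "monoid (S1 S)"
proof (rule monoidI)
  fix x y z assume xyz: "x \<in> carrier (S1 S)" "y \<in> carrier (S1 S)" "z \<in> carrier (S1 S)"
  show "x \<otimes>\<^bsub>S1 S\<^esub> y \<in> carrier (S1 S)"
    using xyz by (cases x; cases y) (auto simp: semigroup_closed[OF S])
  show "x \<otimes>\<^bsub>S1 S\<^esub> y \<otimes>\<^bsub>S1 S\<^esub> z = x \<otimes>\<^bsub>S1 S\<^esub> (y \<otimes>\<^bsub>S1 S\<^esub> z)"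
    using xyz by (cases x; cases y; cases z) (auto simp: semigroup_assoc[OF S])
next
  fix x assume x: "x \<in> carrier (S1 S)"
  have "\<one>\<^bsub>S1 S\<^esub> \<otimes>\<^bsub>S1 S\<^esub> x = x \<and> x \<otimes>\<^bsub>S1 S\<^esub> \<one>\<^bsub>S1 S\<^esub> = x"
  proof (cases "is_monoid S")
    case True
    then obtain e where "\<And>x. x \<in> carrier S \<Longrightarrow> e \<otimes>\<^bsub>S\<^esub> x = x"
      "\<And>x. x \<in> carrier S \<Longrightarrow> x \<otimes>\<^bsub>S\<^esub> e = x" "\<one>\<^bsub>S1 S\<^esub> = Some e"
      using is_monoidE by metis
    then show ?thesis
      using x True by (auto simp: carrier_S1_monoid)
  qed (simp add: S1_adjoined)
  then show "\<one>\<^bsub>S1 S\<^esub> \<otimes>\<^bsub>S1 S\<^esub> x = x" "x \<otimes>\<^bsub>S1 S\<^esub> \<one>\<^bsub>S1 S\<^esub> = x"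
    by simp_all
next
  show "\<one>\<^bsub>S1 S\<^esub> \<in> carrier (S1 S)"
  proof (cases "is_monoid S")
    case True
    then show ?thesis
      using is_monoidE by (metis Some_in_S1)
  qed (simp add: S1_adjoined)
qed


section \<open>The semigroup \<open>T(S)\<close>\<close>

text \<open>For a monoid \<open>M\<close> this is the subsemigroup \<open>T(M)\<close> of \<open>M * R\<^sub>2\<close>. It is stated for
  \<open>M\<close> rather than \<open>S\<close> because words over the generators of \<open>F(S)\<close> take their values over \<open>S\<^sup>1\<close>.\<close>

definition left_multiple_triples :: "('a, 'b) monoid_scheme \<Rightarrow> ('a \<times> 'a \<times> R2) set" where
  "left_multiple_triples M =
     {(p, q, a). q \<in> carrier M \<and> (\<exists>u\<in>carrier M. p = u \<otimes>\<^bsub>M\<^esub> q)}"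

fun Some_triple :: "'a \<times> 'a \<times> R2 \<Rightarrow> 'a option \<times> 'a option \<times> R2" where
  "Some_triple (s, t, a) = (Some s, Some t, a)"

lemma inj_Some_triple: "inj Some_triple"
  by (rule injI) (auto elim!: Some_triple.elims)

lemma Some_triple_mult:
  "Some_triple (T_mult S x y) = T_mult (S1 S) (Some_triple x) (Some_triple y)"
  by (cases "(S, x, y)" rule: T_mult.cases) auto

lemma (in monoid) T_mult_left_multiple_triples:
  assumes "x \<in> left_multiple_triples G" "y \<in> left_multiple_triples G"
  shows "T_mult G x y \<in> left_multiple_triples G"
  using assms
  by (cases "(G, x, y)" rule: T_mult.cases)
     (force simp: left_multiple_triples_def m_assoc)+

text \<open>The product is that of a semidirect product: the last entry of the left factor selects a
  projection of the right factor, whose result then acts on both entries.\<close>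

lemma (in monoid) T_mult_assoc:
  assumes "x \<in> left_multiple_triples G" "y \<in> left_multiple_triples G" "z \<in> left_multiple_triples G"
  shows "T_mult G (T_mult G x y) z = T_mult G x (T_mult G y z)"
  using assms
  by (cases "(G, x, y)" rule: T_mult.cases; cases "(G, y, z)" rule: T_mult.cases)
     (auto simp: left_multiple_triples_def m_assoc)

lemma monoid_idempotent_covered:
  assumes "is_monoid S"
  shows "idempotent_covered S"
proof -
  obtain e where e: "e \<in> carrier S" "\<And>x. x \<in> carrier S \<Longrightarrow> e \<otimes>\<^bsub>S\<^esub> x = x"
    "\<And>x. x \<in> carrier S \<Longrightarrow> x \<otimes>\<^bsub>S\<^esub> e = x"
    using is_monoidE[OF assms] by metis
  then have "e \<in> idempotents S"
    by (simp add: idempotents_def)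
  with e show ?thesis
    unfolding idempotent_covered_def by (metis (no_types))
qed

text \<open>Every triple \<open>(ut, t, \<alpha>)\<close> is a product of generators: choose idempotents with
  \<open>te = t = ft\<close>. Then \<open>(t, t, \<sigma>) = (f, f, \<tau>)(t, e, \<sigma>)\<close>, next
  \<open>(ut, t, \<sigma>) = (uf, f, \<sigma>)(t, t, \<sigma>)\<close> for \<open>u \<in> S\<close>, and finally
  \<open>(ut, t, \<tau>) = (ut, t, \<sigma>)(e, e, \<tau>)\<close>.\<close>

lemma carrier_T_sgp:
  assumes S: "is_semigroup S" and IC: "idempotent_covered S"
  shows "carrier (T_sgp S) = {x. Some_triple x \<in> left_multiple_triples (S1 S)}"
proof -
  interpret M: monoid "S1 S" by (rule monoid_S1[OF S])
  let ?T = "sgp_generate (T_star_R2 S) (T_gens S)"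
  note S_simps = semigroup_closed[OF S] semigroup_assoc[OF S]
  have mult: "T_mult S x y \<in> ?T" if "x \<in> ?T" "y \<in> ?T" for x y
    using sgp_generate.mult[OF that] by (simp add: T_star_R2_def)
  have "x \<in> {x. Some_triple x \<in> left_multiple_triples (S1 S)}" if "x \<in> ?T" for x
    using that
  proof (induction rule: sgp_generate.induct)
    case (incl x)
    then show ?case
      by (auto simp: T_gens_def idempotents_def T_star_R2_def left_multiple_triples_def)
  next
    case (mult x y)
    then show ?case
      using M.T_mult_left_multiple_triples
      by (simp add: T_star_R2_def Some_triple_mult)
  qed
  moreover have "x \<in> ?T" if x: "Some_triple x \<in> left_multiple_triples (S1 S)" for x
  proof -
    obtain s t a where x_eq: "x = (s, t, a)"
      by (cases x)
    obtain u where t: "t \<in> carrier S" and u: "u \<in> carrier (S1 S)" and st: "Some s = u \<otimes>\<^bsub>S1 S\<^esub> Some t"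
      using x by (auto simp: x_eq left_multiple_triples_def)
    obtain e f where ef: "e \<in> carrier S" "e \<otimes>\<^bsub>S\<^esub> e = e" "f \<in> carrier S" "f \<otimes>\<^bsub>S\<^esub> f = f"
      and te: "t \<otimes>\<^bsub>S\<^esub> e = t" and ft: "f \<otimes>\<^bsub>S\<^esub> t = t"
      using IC[unfolded idempotent_covered_def, rule_format, OF t] by (auto simp: idempotents_def)
    have gen_\<sigma>: "(r, d, Sigma2) \<in> ?T"
      if "r \<in> carrier S" "d \<in> carrier S" "d \<otimes>\<^bsub>S\<^esub> d = d" "r \<otimes>\<^bsub>S\<^esub> d = r" for r d
      using that by (intro sgp_generate.incl)
        (auto simp: T_gens_def idempotents_def T_star_R2_def intro!: bexI[of _ "Some r"])
    have gen_\<tau>: "(d, d, Tau2) \<in> ?T" if "d \<in> carrier S" "d \<otimes>\<^bsub>S\<^esub> d = d" for d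
      using that by (intro sgp_generate.incl)
        (auto simp: T_gens_def idempotents_def T_star_R2_def intro!: bexI[of _ "Some d"])
    have "T_mult S (f, f, Tau2) (t, e, Sigma2) \<in> ?T"
      by (intro mult gen_\<sigma> gen_\<tau>) (simp_all add: t ef te)
    then have tt: "(t, t, Sigma2) \<in> ?T"
      by (simp add: ft)
    have s\<sigma>: "(s, t, Sigma2) \<in> ?T"
    proof (cases u)
      case None
      then show ?thesis using tt st by simp
    next
      case (Some v)
      then have v: "v \<in> carrier S" and s: "s = v \<otimes>\<^bsub>S\<^esub> t"
        using u st by auto
      have "T_mult S (v \<otimes>\<^bsub>S\<^esub> f, f, Sigma2) (t, t, Sigma2) \<in> ?T"
        by (intro mult gen_\<sigma> tt) (simp_all add: v ef S_simps)
      then show ?thesis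
        by (simp add: ft s S_simps v ef t)
    qed
    have se: "s \<otimes>\<^bsub>S\<^esub> e = s"
      using st u by (cases u) (auto simp: te S_simps t ef)
    have "T_mult S (s, t, Sigma2) (e, e, Tau2) \<in> ?T"
      by (intro mult gen_\<tau> s\<sigma>) (simp_all add: ef)
    then have "(s, t, Tau2) \<in> ?T"
      by (simp add: te se)
    with s\<sigma> show ?thesis
      by (cases a) (simp_all add: x_eq)
  qed
  ultimately have "?T = {x. Some_triple x \<in> left_multiple_triples (S1 S)}"
    by blast
  then show ?thesis
    by (simp add: T_sgp_def)
qed


section \<open>Evaluating words\<close>

fun letter_value :: "('a, 'b) monoid_scheme \<Rightarrow> 'a gen \<Rightarrow> 'a \<times> 'a \<times> R2" where
  "letter_value M Hbar = (\<one>\<^bsub>M\<^esub>, \<one>\<^bsub>M\<^esub>, Tau2)"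
| "letter_value M (Bar s) = (s, \<one>\<^bsub>M\<^esub>, Sigma2)"

text \<open>The homomorphic extension of \<open>letter_value\<close> to nonempty words; the empty word is not
  an element of the free semigroup and has no specified value.\<close>

fun word_value :: "('a, 'b) monoid_scheme \<Rightarrow> 'a gen list \<Rightarrow> 'a \<times> 'a \<times> R2" where
  "word_value M [x] = letter_value M x"
| "word_value M (x # y # w) = T_mult M (letter_value M x) (word_value M (y # w))"

abbreviation words :: "('a, 'b) monoid_scheme \<Rightarrow> 'a option gen list set" where
  "words S \<equiv> carrier (free_sgp (Xbar S))"

abbreviation word_cong :: "('a, 'b) monoid_scheme \<Rightarrow> ('a option gen list \<times> 'a option gen list) set" where
  "word_cong S \<equiv> generated_congruence (free_sgp (Xbar S)) (F_rels S)"

lemma words_iff: "w \<in> words S \<longleftrightarrow> w \<noteq> [] \<and> set w \<subseteq> Xbar S"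
  by (auto simp: free_sgp_def)

lemma mult_free_sgp [simp]: "v \<otimes>\<^bsub>free_sgp X\<^esub> w = v @ w"
  by (simp add: free_sgp_def)

lemma Hbar_in_Xbar [simp]: "Hbar \<in> Xbar S"
  and Bar_in_Xbar [simp]: "Bar s \<in> Xbar S \<longleftrightarrow> s \<in> carrier (S1 S)"
  by (auto simp: Xbar_def)

text \<open>The final letter of a normal word is governed by the last entry of its value, so that the
  normal words with and without a trailing \<open>Hbar\<close> can be treated together.\<close>

definition normal_word :: "'a option \<Rightarrow> 'a option \<Rightarrow> R2 \<Rightarrow> 'a option gen list" where
  "normal_word s t a = [Bar s, Hbar, Bar t] @ (case a of Sigma2 \<Rightarrow> [] | Tau2 \<Rightarrow> [Hbar])"

text \<open>The classes whose value avoids the adjoined identity. This is the common form of the two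
  targets of the isomorphism: \<open>A(S)\<close> for a monoid \<open>S\<close>, and \<open>A\<^sub>1\<close> otherwise.\<close>

definition Some_valued_A :: "('a, 'b) monoid_scheme \<Rightarrow> 'a option gen list set set set" where
  "Some_valued_A S = A_word S ` {w \<in> words S. word_value (S1 S) w \<in> range Some_triple}"

context
  fixes S :: "('a, 'b) monoid_scheme"
  assumes S: "is_semigroup S"
begin

interpretation M: monoid "S1 S"
  by (rule monoid_S1[OF S])

lemma letter_value_in: "x \<in> Xbar S \<Longrightarrow> letter_value (S1 S) x \<in> left_multiple_triples (S1 S)"
  by (cases x) (auto simp: left_multiple_triples_def)

lemma word_value_Cons:
  "w \<noteq> [] \<Longrightarrow> word_value M (x # w) = T_mult M (letter_value M x) (word_value M w)"
  by (cases w) simp_all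

lemma word_value_in: "w \<in> words S \<Longrightarrow> word_value (S1 S) w \<in> left_multiple_triples (S1 S)"
proof (induction w)
  case (Cons x w)
  then have x: "letter_value (S1 S) x \<in> left_multiple_triples (S1 S)"
    by (simp add: letter_value_in words_iff)
  show ?case
  proof (cases "w = []")
    case False
    then show ?thesis
      using Cons x by (simp add: word_value_Cons words_iff M.T_mult_left_multiple_triples)
  qed (simp add: x)
qed (simp add: words_iff)

lemma word_value_append:
  assumes "v \<in> words S" "w \<in> words S"
  shows "word_value (S1 S) (v @ w) = T_mult (S1 S) (word_value (S1 S) v) (word_value (S1 S) w)"
  using assms(1)
proof (induction v)
  case (Cons x v)
  have w: "w \<noteq> []" using assms(2) by (simp add: words_iff)
  show ?case
  proof (cases "v = []")
    case True
    then show ?thesis using w by (simp add: word_value_Cons)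
  next
    case False
    then have "x \<in> Xbar S" "v \<in> words S"
      using Cons.prems by (simp_all add: words_iff)
    with Cons.IH assms(2) False show ?thesis
      by (simp add: word_value_Cons M.T_mult_assoc letter_value_in word_value_in)
  qed
qed (simp add: words_iff)

lemma F_rels_words: "F_rels S \<subseteq> words S \<times> words S"
  by (auto simp: F_rels_def words_iff)

lemma F_rels_value:
  assumes "(v, w) \<in> F_rels S"
  shows "word_value (S1 S) v = word_value (S1 S) w"
proof -
  have "T_mult (S1 S) (letter_value (S1 S) x) (letter_value (S1 S) x) = letter_value (S1 S) x"
    if "x \<in> Xbar S" for x
    using that by (cases x) auto
  then show ?thesis
    using assms by (auto simp: F_rels_def)
qed

lemma congruence_word_cong: "congruence (free_sgp (Xbar S)) (word_cong S)"
  by (rule congruence_generated[OF _ F_rels_words]) (auto simp: words_iff)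

text \<open>Having equal values is a congruence that contains the defining relations.\<close>

lemma word_cong_value:
  assumes "(v, w) \<in> word_cong S"
  shows "word_value (S1 S) v = word_value (S1 S) w"
proof -
  let ?c = "{(v, w). v \<in> words S \<and> w \<in> words S \<and> word_value (S1 S) v = word_value (S1 S) w}"
  have "congruence (free_sgp (Xbar S)) ?c"
  proof (rule congruenceI)
    show "equiv (words S) ?c"
      by (auto intro!: equivI refl_onI symI transI)
  qed (auto simp: word_value_append words_iff)
  then have "word_cong S \<subseteq> ?c"
    using F_rels_words F_rels_value by (intro generated_congruence_least) auto
  then show ?thesis
    using assms by auto
qed

lemma normal_word_in: "s \<in> carrier (S1 S) \<Longrightarrow> t \<in> carrier (S1 S) \<Longrightarrow> normal_word s t a \<in> words S"
  by (auto simp: normal_word_def words_iff split: R2.split)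

lemma normal_word_value:
  "s \<in> carrier (S1 S) \<Longrightarrow> t \<in> carrier (S1 S) \<Longrightarrow>
    word_value (S1 S) (normal_word s t a) = (s \<otimes>\<^bsub>S1 S\<^esub> t, t, a)"
  by (cases a) (simp_all add: normal_word_def)

lemma word_cong_rel:
  assumes "(l, r) \<in> F_rels S" "set u \<subseteq> Xbar S" "set v \<subseteq> Xbar S"
  shows "(u @ l @ v, u @ r @ v) \<in> word_cong S"
proof -
  note C = congruence_word_cong
  have "(l, r) \<in> word_cong S"
    using assms(1) generated_congruence_incl by blast
  then have "(l @ v, r @ v) \<in> word_cong S"
    using congruence_multR[OF C, of l r v] assms(3) by (cases "v = []") (auto simp: words_iff)
  then show ?thesis
    using congruence_multL[OF C, of "l @ v" "r @ v" u] assms(2) by (cases "u = []") (auto simp: words_iff)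
qed

text \<open>Writing \<open>\<^bold>e\<close> for the letter of the identity, \<open>\<^bold>s = \<^bold>s \<^bold>e = \<^bold>s \<^bold>h \<^bold>e\<close> and
  \<open>\<^bold>h = \<^bold>e \<^bold>h = \<^bold>h \<^bold>e \<^bold>h = \<^bold>e \<^bold>h \<^bold>e \<^bold>h\<close>.\<close>

lemma word_cong_normal_letter:
  assumes x: "x \<in> Xbar S"
  shows "\<exists>s\<in>carrier (S1 S). \<exists>t\<in>carrier (S1 S). \<exists>a. ([x], normal_word s t a) \<in> word_cong S"
proof -
  note trans = congruence_trans[OF congruence_word_cong]
  note sym = congruence_sym[OF congruence_word_cong]
  let ?e = "\<one>\<^bsub>S1 S\<^esub>"
  have h1: "([Hbar, Bar ?e], [Bar ?e]) \<in> F_rels S" and "1h": "([Bar ?e, Hbar], [Hbar]) \<in> F_rels S"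
    by (auto simp: F_rels_def)
  show ?thesis
  proof (cases x)
    case Hbar
    have "([Hbar, Bar ?e, Hbar], [Bar ?e, Hbar, Bar ?e, Hbar]) \<in> word_cong S"
      using sym[OF word_cong_rel[OF "1h", of "[]" "[Bar ?e, Hbar]"]] by simp
    moreover have "([Bar ?e, Hbar], [Hbar, Bar ?e, Hbar]) \<in> word_cong S"
      using sym[OF word_cong_rel[OF h1, of "[]" "[Hbar]"]] by simp
    moreover have "([Hbar], [Bar ?e, Hbar]) \<in> word_cong S"
      using sym[OF word_cong_rel[OF "1h", of "[]" "[]"]] by simp
    ultimately have "([Hbar], normal_word ?e ?e Tau2) \<in> word_cong S"
      using trans unfolding normal_word_def by (metis R2.case(2) append_Cons append_Nil)
    then show ?thesis using Hbar by blast
  next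
    case (Bar s)
    then have s: "s \<in> carrier (S1 S)" using x by simp
    then have s1: "([Bar s, Bar ?e], [Bar s]) \<in> F_rels S"
      by (auto simp: F_rels_def)
    have "([Bar s], [Bar s, Bar ?e]) \<in> word_cong S"
      using sym[OF word_cong_rel[OF s1, of "[]" "[]"]] by simp
    moreover have "([Bar s, Bar ?e], [Bar s, Hbar, Bar ?e]) \<in> word_cong S"
      using sym[OF word_cong_rel[OF h1, of "[Bar s]" "[]"]] s by simp
    ultimately have "([Bar s], normal_word s ?e Sigma2) \<in> word_cong S"
      using trans by (force simp: normal_word_def)
    then show ?thesis using Bar s by blast
  qed
qed

text \<open>A letter on the left of \<open>\<^bold>s \<^bold>h \<^bold>t\<close> is absorbed: a letter \<open>\<^bold>r\<close> replaces \<open>\<^bold>s\<close> because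
  \<open>\<^bold>r \<^bold>s = \<^bold>r\<close>, and \<open>\<^bold>h\<close> collapses the word to \<open>\<^bold>h\<close> followed by the letter of \<open>st\<close>, to which
  the letter of the identity is prefixed.\<close>

lemma word_cong_normal_Cons:
  assumes x: "x \<in> Xbar S" and s: "s \<in> carrier (S1 S)" and t: "t \<in> carrier (S1 S)"
  shows "\<exists>s'\<in>carrier (S1 S). \<exists>t'\<in>carrier (S1 S).
    (x # normal_word s t a, normal_word s' t' a) \<in> word_cong S"
proof -
  note trans = congruence_trans[OF congruence_word_cong]
  note sym = congruence_sym[OF congruence_word_cong]
  let ?e = "\<one>\<^bsub>S1 S\<^esub>"
  let ?v = "case a of Sigma2 \<Rightarrow> [] | Tau2 \<Rightarrow> [Hbar]"
  have v: "set ?v \<subseteq> Xbar S" by (cases a) auto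
  show ?thesis
  proof (cases x)
    case Hbar
    have st: "s \<otimes>\<^bsub>S1 S\<^esub> t \<in> carrier (S1 S)" using s t by simp
    have hsht: "([Hbar, Bar s, Hbar, Bar t], [Hbar, Bar (s \<otimes>\<^bsub>S1 S\<^esub> t)]) \<in> F_rels S"
      and "1h": "([Bar ?e, Hbar], [Hbar]) \<in> F_rels S"
      using s t by (auto simp: F_rels_def)
    have "(Hbar # normal_word s t a, [Hbar, Bar (s \<otimes>\<^bsub>S1 S\<^esub> t)] @ ?v) \<in> word_cong S"
      using word_cong_rel[OF hsht, of "[]" ?v] v by (simp add: normal_word_def)
    moreover have "([Hbar, Bar (s \<otimes>\<^bsub>S1 S\<^esub> t)] @ ?v, normal_word ?e (s \<otimes>\<^bsub>S1 S\<^esub> t) a) \<in> word_cong S"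
      using sym[OF word_cong_rel[OF "1h", of "[]" "Bar (s \<otimes>\<^bsub>S1 S\<^esub> t) # ?v"]] v st
      by (simp add: normal_word_def)
    ultimately show ?thesis
      using Hbar trans st by blast
  next
    case (Bar r)
    then have r: "r \<in> carrier (S1 S)" using x by simp
    then have "([Bar r, Bar s], [Bar r]) \<in> F_rels S"
      using s by (auto simp: F_rels_def)
    from word_cong_rel[OF this, of "[]" "[Hbar, Bar t] @ ?v"]
    have "(Bar r # normal_word s t a, normal_word r t a) \<in> word_cong S"
      using v t by (simp add: normal_word_def)
    then show ?thesis using Bar r t by blast
  qed
qed

lemma word_cong_normal:
  "w \<in> words S \<Longrightarrow>
    \<exists>s\<in>carrier (S1 S). \<exists>t\<in>carrier (S1 S). \<exists>a. (w, normal_word s t a) \<in> word_cong S"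
proof (induction w)
  case (Cons x w)
  then have x: "x \<in> Xbar S" by (simp add: words_iff)
  show ?case
  proof (cases "w = []")
    case True
    then show ?thesis using word_cong_normal_letter[OF x] by simp
  next
    case False
    then have "w \<in> words S" using Cons.prems by (simp add: words_iff)
    with Cons.IH obtain s t a where st: "s \<in> carrier (S1 S)" "t \<in> carrier (S1 S)"
      and "(w, normal_word s t a) \<in> word_cong S" by blast
    then have "(x # w, x # normal_word s t a) \<in> word_cong S"
      using congruence_multL[OF congruence_word_cong, of w _ "[x]"] x by (simp add: words_iff)
    then show ?thesis
      using word_cong_normal_Cons[OF x st, of a] congruence_trans[OF congruence_word_cong] by blast
  qed
qed (simp add: words_iff)


section \<open>The semigroup \<open>A(S)\<close>\<close>

lemma carrier_F_sgp: "carrier (F_sgp S) = F_word S ` words S"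
  unfolding F_sgp_def presented_sgp_def quotient_sgp_def F_word_def quotient_def by simp blast

lemma mult_F_sgp:
  "v \<in> words S \<Longrightarrow> w \<in> words S \<Longrightarrow> F_word S v \<otimes>\<^bsub>F_sgp S\<^esub> F_word S w = F_word S (v @ w)"
  using quotient_mult_class[OF congruence_word_cong, of v w]
  by (simp add: F_sgp_def presented_sgp_def F_word_def)

lemma F_word_eq_iff:
  "v \<in> words S \<Longrightarrow> w \<in> words S \<Longrightarrow> F_word S v = F_word S w \<longleftrightarrow> (v, w) \<in> word_cong S"
  unfolding F_word_def by (rule eq_equiv_class_iff[OF congruence_equiv[OF congruence_word_cong]])

lemma rho_normal:
  "rho S = {(F_word S (normal_word s t a), F_word S (normal_word r t a)) | r s t a.
     r \<in> carrier (S1 S) \<and> s \<in> carrier (S1 S) \<and> t \<in> carrier (S1 S) \<and>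
     s \<otimes>\<^bsub>S1 S\<^esub> t = r \<otimes>\<^bsub>S1 S\<^esub> t}" (is "_ = ?R")
proof -
  have n: "[Bar s, Hbar, Bar t] = normal_word s t Sigma2"
    "[Bar s, Hbar, Bar t, Hbar] = normal_word s t Tau2" for s t
    by (simp_all add: normal_word_def)
  show ?thesis
    unfolding rho_def n
  proof (intro equalityI subsetI)
    fix x assume "x \<in> ?R"
    then obtain r s t a where "x = (F_word S (normal_word s t a), F_word S (normal_word r t a))"
      "r \<in> carrier (S1 S)" "s \<in> carrier (S1 S)" "t \<in> carrier (S1 S)"
      "s \<otimes>\<^bsub>S1 S\<^esub> t = r \<otimes>\<^bsub>S1 S\<^esub> t" by blast
    then show "x \<in> {(F_word S (normal_word s t Sigma2), F_word S (normal_word r t Sigma2)) | r s t.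
        r \<in> carrier (S1 S) \<and> s \<in> carrier (S1 S) \<and> t \<in> carrier (S1 S) \<and>
        s \<otimes>\<^bsub>S1 S\<^esub> t = r \<otimes>\<^bsub>S1 S\<^esub> t} \<union>
      {(F_word S (normal_word s t Tau2), F_word S (normal_word r t Tau2)) | r s t.
        r \<in> carrier (S1 S) \<and> s \<in> carrier (S1 S) \<and> t \<in> carrier (S1 S) \<and>
        s \<otimes>\<^bsub>S1 S\<^esub> t = r \<otimes>\<^bsub>S1 S\<^esub> t}"
      by (cases a) blast+
  qed blast
qed

text \<open>Read through normal forms, the condition \<open>st = rt\<close> in the definition of \<open>\<rho>\<close> says that the
  two sides have the same value. This turns \<open>\<rho>\<close> into the kernel of the evaluation, which makes
  it evident that \<open>\<rho>\<close> is a congruence.\<close>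

lemma rho_eq:
  "rho S = {(F_word S v, F_word S w) | v w.
     v \<in> words S \<and> w \<in> words S \<and> word_value (S1 S) v = word_value (S1 S) w}" (is "_ = ?K")
proof (intro equalityI subsetI)
  fix x assume "x \<in> rho S"
  then show "x \<in> ?K"
    unfolding rho_normal using normal_word_in normal_word_value by (smt (verit) mem_Collect_eq)
next
  fix x assume "x \<in> ?K"
  then obtain v w where x: "x = (F_word S v, F_word S w)" and vw: "v \<in> words S" "w \<in> words S"
    and eq: "word_value (S1 S) v = word_value (S1 S) w" by blast
  from word_cong_normal[OF vw(1)] obtain s t a where s: "s \<in> carrier (S1 S)" "t \<in> carrier (S1 S)"
    and v: "(v, normal_word s t a) \<in> word_cong S" by blast
  from word_cong_normal[OF vw(2)] obtain r t' a' where r: "r \<in> carrier (S1 S)" "t' \<in> carrier (S1 S)"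
    and w: "(w, normal_word r t' a') \<in> word_cong S" by blast
  have "t' = t" "a' = a" "s \<otimes>\<^bsub>S1 S\<^esub> t = r \<otimes>\<^bsub>S1 S\<^esub> t"
    using eq s r word_cong_value[OF v] word_cong_value[OF w] by (auto simp: normal_word_value)
  moreover have "x = (F_word S (normal_word s t a), F_word S (normal_word r t' a'))"
    using v w x vw s r by (simp add: F_word_eq_iff normal_word_in)
  ultimately show "x \<in> rho S"
    unfolding rho_normal using s r by blast
qed

lemma rho_iff:
  assumes "v \<in> words S" "w \<in> words S"
  shows "(F_word S v, F_word S w) \<in> rho S \<longleftrightarrow> word_value (S1 S) v = word_value (S1 S) w"
proof
  assume "(F_word S v, F_word S w) \<in> rho S"
  then obtain v' w' where "v' \<in> words S" "w' \<in> words S" "F_word S v = F_word S v'"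
    "F_word S w = F_word S w'" "word_value (S1 S) v' = word_value (S1 S) w'"
    unfolding rho_eq by blast
  then show "word_value (S1 S) v = word_value (S1 S) w"
    using assms word_cong_value by (metis F_word_eq_iff)
qed (use assms in \<open>auto simp: rho_eq\<close>)

lemma congruence_rho: "congruence (F_sgp S) (rho S)"
proof (rule congruenceI)
  have sub: "rho S \<subseteq> carrier (F_sgp S) \<times> carrier (F_sgp S)"
    by (auto simp: rho_eq carrier_F_sgp)
  show "equiv (carrier (F_sgp S)) (rho S)"
  proof (intro equivI refl_onI symI transI)
    show "rho S \<subseteq> carrier (F_sgp S) \<times> carrier (F_sgp S)" by (fact sub)
  next
    fix x assume "x \<in> carrier (F_sgp S)"
    then show "(x, x) \<in> rho S"
      by (auto simp: carrier_F_sgp rho_iff)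
  next
    fix x y assume xy: "(x, y) \<in> rho S"
    then obtain u v where "x = F_word S u" "y = F_word S v" "u \<in> words S" "v \<in> words S"
      using sub unfolding carrier_F_sgp by blast
    with xy show "(y, x) \<in> rho S"
      by (simp add: rho_iff)
  next
    fix x y z assume xyz: "(x, y) \<in> rho S" "(y, z) \<in> rho S"
    then obtain u v w where "x = F_word S u" "y = F_word S v" "z = F_word S w"
      "u \<in> words S" "v \<in> words S" "w \<in> words S"
      using sub unfolding carrier_F_sgp by blast
    with xyz show "(x, z) \<in> rho S"
      by (simp add: rho_iff)
  qed
next
  fix x y z assume "(x, y) \<in> rho S" "z \<in> carrier (F_sgp S)"
  then obtain u v w where "u \<in> words S" "v \<in> words S" "w \<in> words S"
    "x = F_word S u" "y = F_word S v" "z = F_word S w"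
    "word_value (S1 S) u = word_value (S1 S) v"
    unfolding rho_eq carrier_F_sgp by blast
  moreover from this have "u @ w \<in> words S" "v @ w \<in> words S" "w @ u \<in> words S" "w @ v \<in> words S"
    by (auto simp: words_iff)
  ultimately show "(z \<otimes>\<^bsub>F_sgp S\<^esub> x, z \<otimes>\<^bsub>F_sgp S\<^esub> y) \<in> rho S"
    and "(x \<otimes>\<^bsub>F_sgp S\<^esub> z, y \<otimes>\<^bsub>F_sgp S\<^esub> z) \<in> rho S"
    by (simp_all add: mult_F_sgp rho_iff word_value_append)
qed

lemma carrier_A_sgp: "carrier (A_sgp S) = A_word S ` words S"
  unfolding A_sgp_def quotient_sgp_def A_word_def quotient_def by (simp add: carrier_F_sgp) blast

lemma mult_A_sgp:
  "v \<in> words S \<Longrightarrow> w \<in> words S \<Longrightarrow> A_word S v \<otimes>\<^bsub>A_sgp S\<^esub> A_word S w = A_word S (v @ w)"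
  using quotient_mult_class[OF congruence_rho, of "F_word S v" "F_word S w"]
  by (simp add: A_sgp_def A_word_def carrier_F_sgp mult_F_sgp)

lemma A_word_eq_iff:
  assumes "v \<in> words S" "w \<in> words S"
  shows "A_word S v = A_word S w \<longleftrightarrow> word_value (S1 S) v = word_value (S1 S) w"
  unfolding A_word_def rho_iff[OF assms, symmetric]
  by (rule eq_equiv_class_iff[OF congruence_equiv[OF congruence_rho]])
     (use assms in \<open>auto simp: carrier_F_sgp\<close>)

lemma ex_word_value:
  assumes "x \<in> left_multiple_triples (S1 S)"
  shows "\<exists>w\<in>words S. word_value (S1 S) w = x"
proof -
  obtain u q a where "u \<in> carrier (S1 S)" "q \<in> carrier (S1 S)" "x = (u \<otimes>\<^bsub>S1 S\<^esub> q, q, a)"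
    using assms by (auto simp: left_multiple_triples_def)
  then show ?thesis
    by (intro bexI[of _ "normal_word u q a"]) (simp_all add: normal_word_value normal_word_in)
qed

lemma subsemigroup_Some_valued_A: "subsemigroup (Some_valued_A S) (A_sgp S)"
  unfolding subsemigroup_def
proof (intro conjI ballI)
  show "Some_valued_A S \<subseteq> carrier (A_sgp S)"
    by (auto simp: Some_valued_A_def carrier_A_sgp)
next
  fix x y assume "x \<in> Some_valued_A S" "y \<in> Some_valued_A S"
  then obtain v w p q where vw: "v \<in> words S" "w \<in> words S" "x = A_word S v" "y = A_word S w"
    "word_value (S1 S) v = Some_triple p" "word_value (S1 S) w = Some_triple q"
    unfolding Some_valued_A_def by blast
  then have "word_value (S1 S) (v @ w) = Some_triple (T_mult S p q)"
    by (simp add: word_value_append Some_triple_mult)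
  moreover have "v @ w \<in> words S" using vw by (auto simp: words_iff)
  ultimately show "x \<otimes>\<^bsub>A_sgp S\<^esub> y \<in> Some_valued_A S"
    using vw by (auto simp: Some_valued_A_def mult_A_sgp)
qed

text \<open>The isomorphism sends a triple to the class of any word that has this value. It is
  a homomorphism because evaluation is, and injective because equal classes have equal values.\<close>

lemma T_sgp_iso_Some_valued_A:
  assumes IC: "idempotent_covered S"
  shows "T_sgp S \<cong> (A_sgp S)\<lparr>carrier := Some_valued_A S\<rparr>"
proof -
  define word where "word x = (SOME w. w \<in> words S \<and> word_value (S1 S) w = Some_triple x)" for x
  have word: "word x \<in> words S" "word_value (S1 S) (word x) = Some_triple x"
    if "x \<in> carrier (T_sgp S)" for x
  proof -
    have "\<exists>w. w \<in> words S \<and> word_value (S1 S) w = Some_triple x"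
      using ex_word_value[of "Some_triple x"] that by (auto simp: carrier_T_sgp[OF S IC])
    from someI_ex[OF this] show "word x \<in> words S" "word_value (S1 S) (word x) = Some_triple x"
      by (auto simp: word_def)
  qed
  have mult_T: "x \<otimes>\<^bsub>T_sgp S\<^esub> y = T_mult S x y" for x y
    by (simp add: T_sgp_def T_star_R2_def)
  have "(\<lambda>x. A_word S (word x)) \<in> iso (T_sgp S) ((A_sgp S)\<lparr>carrier := Some_valued_A S\<rparr>)"
  proof (rule isoI)
    show "(\<lambda>x. A_word S (word x)) \<in> hom (T_sgp S) ((A_sgp S)\<lparr>carrier := Some_valued_A S\<rparr>)"
    proof (rule homI)
      fix x assume "x \<in> carrier (T_sgp S)"
      then show "A_word S (word x) \<in> carrier ((A_sgp S)\<lparr>carrier := Some_valued_A S\<rparr>)"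
        using word[of x] by (auto simp: Some_valued_A_def)
    next
      fix x y assume xy: "x \<in> carrier (T_sgp S)" "y \<in> carrier (T_sgp S)"
      then have xy': "T_mult S x y \<in> carrier (T_sgp S)"
        using M.T_mult_left_multiple_triples
        by (simp add: carrier_T_sgp[OF S IC] Some_triple_mult)
      have app: "word x @ word y \<in> words S"
        using word(1)[OF xy(1)] word(1)[OF xy(2)] by (auto simp: words_iff)
      show "A_word S (word (x \<otimes>\<^bsub>T_sgp S\<^esub> y)) =
          A_word S (word x) \<otimes>\<^bsub>(A_sgp S)\<lparr>carrier := Some_valued_A S\<rparr>\<^esub> A_word S (word y)"
        using word[OF xy(1)] word[OF xy(2)] word[OF xy'] app
        by (simp add: mult_T mult_A_sgp A_word_eq_iff word_value_append Some_triple_mult)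
    qed
    have "inj_on (\<lambda>x. A_word S (word x)) (carrier (T_sgp S))"
      using word inj_Some_triple by (auto intro!: inj_onI simp: A_word_eq_iff dest: injD)
    moreover have "y \<in> (\<lambda>x. A_word S (word x)) ` carrier (T_sgp S)" if "y \<in> Some_valued_A S" for y
    proof -
      from that obtain w x where w: "w \<in> words S" "y = A_word S w"
        "word_value (S1 S) w = Some_triple x"
        by (auto simp: Some_valued_A_def)
      then have "x \<in> carrier (T_sgp S)"
        using word_value_in[of w] by (simp add: carrier_T_sgp[OF S IC])
      moreover from this have "y = A_word S (word x)"
        using w word[of x] by (simp add: A_word_eq_iff)
      ultimately show ?thesis
        by blast
    qed
    moreover have "A_word S (word x) \<in> Some_valued_A S" if "x \<in> carrier (T_sgp S)" for x
      using word[OF that] by (auto simp: Some_valued_A_def)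
    ultimately show "bij_betw (\<lambda>x. A_word S (word x)) (carrier (T_sgp S))
        (carrier ((A_sgp S)\<lparr>carrier := Some_valued_A S\<rparr>))"
      by (auto simp: bij_betw_def)
  qed
  then show ?thesis
    by (auto simp: is_iso_def)
qed

lemma Some_valued_A_monoid:
  assumes "is_monoid S"
  shows "Some_valued_A S = carrier (A_sgp S)"
proof -
  have "word_value (S1 S) w \<in> range Some_triple" if w: "w \<in> words S" for w
  proof -
    obtain s t a where "word_value (S1 S) w = (Some s, Some t, a)"
      using word_value_in[OF w] assms
      by (auto simp: left_multiple_triples_def carrier_S1_monoid)
    then show ?thesis by (metis Some_triple.simps rangeI)
  qed
  then show ?thesis
    by (auto simp: Some_valued_A_def carrier_A_sgp)
qed

text \<open>The two families in the definition of \<open>A\<^sub>1\<close> whose words start with \<open>Hbar\<close> are those of the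
  normal words that start with the adjoined identity.\<close>

lemma A1_eq_normal_words:
  assumes "\<not> is_monoid S"
  shows "A1 S = {A_word S (normal_word u (Some s) a) | u s a. u \<in> carrier (S1 S) \<and> s \<in> carrier S}"
    (is "_ = ?N")
proof -
  note one = S1_adjoined[OF assms]
  have h: "A_word S [Hbar, Bar (Some s)] = A_word S (normal_word None (Some s) Sigma2)"
    "A_word S [Hbar, Bar (Some s), Hbar] = A_word S (normal_word None (Some s) Tau2)"
    if "s \<in> carrier S" for s
  proof -
    have "[Hbar, Bar (Some s)] \<in> words S" "[Hbar, Bar (Some s), Hbar] \<in> words S"
      using that by (simp_all add: words_iff)
    then show "A_word S [Hbar, Bar (Some s)] = A_word S (normal_word None (Some s) Sigma2)"
      "A_word S [Hbar, Bar (Some s), Hbar] = A_word S (normal_word None (Some s) Tau2)"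
      using that one by (simp_all add: A_word_eq_iff normal_word_in normal_word_value)
  qed
  have r: "A_word S [Bar (Some r), Hbar, Bar (Some s)] = A_word S (normal_word (Some r) (Some s) Sigma2)"
    "A_word S [Bar (Some r), Hbar, Bar (Some s), Hbar] = A_word S (normal_word (Some r) (Some s) Tau2)"
    for r s
    by (simp_all add: normal_word_def)
  have in_A1: "A_word S (normal_word u (Some s) a) \<in> A1 S"
    if u: "u \<in> carrier (S1 S)" and s: "s \<in> carrier S" for u s a
  proof (cases u)
    case None
    have "A_word S [Hbar, Bar (Some s)] \<in> A1 S" "A_word S [Hbar, Bar (Some s), Hbar] \<in> A1 S"
      unfolding A1_def using s by blast+
    then show ?thesis
      using None by (cases a) (simp_all add: h[OF s])
  next
    case (Some r)
    then have "r \<in> carrier S" using u by simp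
    then have "A_word S [Bar (Some r), Hbar, Bar (Some s)] \<in> A1 S"
      "A_word S [Bar (Some r), Hbar, Bar (Some s), Hbar] \<in> A1 S"
      unfolding A1_def using s by blast+
    then show ?thesis
      using Some by (cases a) (simp_all add: r)
  qed
  have in_N: "A_word S (normal_word u (Some s) a) \<in> ?N"
    if "u \<in> carrier (S1 S)" "s \<in> carrier S" for u s a
    using that by blast
  have "x \<in> ?N" if "x \<in> A1 S" for x
    using that[unfolded A1_def r]
  proof (elim UnE CollectE exE conjE)
    fix s assume "x = A_word S [Hbar, Bar (Some s)]" "s \<in> carrier S"
    then show ?thesis using in_N[of None s Sigma2] one h[of s] by simp
  next
    fix s assume "x = A_word S [Hbar, Bar (Some s), Hbar]" "s \<in> carrier S"
    then show ?thesis using in_N[of None s Tau2] one h[of s] by simp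
  next
    fix r s assume "x = A_word S (normal_word (Some r) (Some s) Sigma2)" "r \<in> carrier S" "s \<in> carrier S"
    then show ?thesis using in_N[of "Some r" s Sigma2] by simp
  next
    fix r s assume "x = A_word S (normal_word (Some r) (Some s) Tau2)" "r \<in> carrier S" "s \<in> carrier S"
    then show ?thesis using in_N[of "Some r" s Tau2] by simp
  qed
  with in_A1 show ?thesis by blast
qed

lemma Some_valued_A_eq_A1:
  assumes "\<not> is_monoid S"
  shows "Some_valued_A S = A1 S"
proof (intro equalityI subsetI)
  fix y assume "y \<in> Some_valued_A S"
  then obtain w p q a where w: "w \<in> words S" "y = A_word S w"
    "word_value (S1 S) w = (Some p, Some q, a)"
    by (auto simp: Some_valued_A_def)
  then obtain u where u: "u \<in> carrier (S1 S)" "q \<in> carrier S" "Some p = u \<otimes>\<^bsub>S1 S\<^esub> Some q"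
    using word_value_in[of w] by (auto simp: left_multiple_triples_def)
  then have "y = A_word S (normal_word u (Some q) a)"
    using w by (simp add: A_word_eq_iff normal_word_in normal_word_value)
  with u show "y \<in> A1 S"
    unfolding A1_eq_normal_words[OF assms] by blast
next
  fix y assume "y \<in> A1 S"
  then obtain u s a where y: "y = A_word S (normal_word u (Some s) a)"
    and u: "u \<in> carrier (S1 S)" "s \<in> carrier S"
    unfolding A1_eq_normal_words[OF assms] by blast
  obtain p where "u \<otimes>\<^bsub>S1 S\<^esub> Some s = Some p"
    by (cases u) auto
  then have "word_value (S1 S) (normal_word u (Some s) a) = Some_triple (p, s, a)"
    using u by (simp add: normal_word_value)
  then have "word_value (S1 S) (normal_word u (Some s) a) \<in> range Some_triple"
    by (rule range_eqI)
  then show "y \<in> Some_valued_A S"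
    unfolding Some_valued_A_def y using u by (intro imageI) (simp add: normal_word_in)
qed

end

theorem proposition3p3:
  fixes S :: "('a, 'b) monoid_scheme"
  assumes "is_semigroup S"
  shows "(is_monoid S \<longrightarrow> T_sgp S \<cong> A_sgp S) \<and>
         (idempotent_covered S \<and> \<not> is_monoid S \<longrightarrow>
            subsemigroup (A1 S) (A_sgp S) \<and> T_sgp S \<cong> (A_sgp S)\<lparr>carrier := A1 S\<rparr>)"
proof (intro conjI impI)
  assume "is_monoid S"
  then show "T_sgp S \<cong> A_sgp S"
    using T_sgp_iso_Some_valued_A[OF assms monoid_idempotent_covered] Some_valued_A_monoid[OF assms]
    by simp
next
  assume "idempotent_covered S \<and> \<not> is_monoid S"
  then show "subsemigroup (A1 S) (A_sgp S)" "T_sgp S \<cong> (A_sgp S)\<lparr>carrier := A1 S\<rparr>"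
    using T_sgp_iso_Some_valued_A[OF assms] subsemigroup_Some_valued_A[OF assms]
      Some_valued_A_eq_A1[OF assms]
    by auto
qed

end
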